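(* Let $\Psi:\mathbb{R}\to(0,\infty)$ be a bounded, nondecreasing $\mathcal{C}^2$ function with $\Psi(0)=\Psi'(0)=1$. Let $v<0$, let $(u_0,v_0)=(h(v),v)$, where $h$ is the critical curve, and let $(u_n,v_n)_{n\ge0}$ be given by $v_{n+1}=u_n+v_n$, $u_{n+1}=u_n\Psi(v_{n+1})$. Then $$u_n\sim\frac{2}{n^2}\quad\text{and}\quad v_n\sim-\frac2n\qquad\text{as }n\to\infty.$$
   Context: The critical curve is $h(v):=\inf\{u\in[0,\infty):\text{the recursion started from }(u_0,v_0)=(u,v)\text{ satisfies }\lim_{n\to\infty}v_n=\infty\}$, $v\in\mathbb{R}$. *)

theory Defs
  imports "HOL-Analysis.Analysis" "HOL-Library.Landau_Symbols"
begin

definition C2 :: "(real \<Rightarrow> real) \<Rightarrow> bool" where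
  "C2 f \<longleftrightarrow>
     (\<forall>x. f differentiable (at x)) \<and>
     (\<forall>x. deriv f differentiable (at x)) \<and>
     continuous_on UNIV (deriv (deriv f))"

text \<open>The state at time \<open>n\<close> is the pair \<open>(u\<^sub>n, v\<^sub>n)\<close>. Note that \<open>u\<^sub>n\<^sub>+\<^sub>1\<close> is
  computed from the already updated value \<open>v\<^sub>n\<^sub>+\<^sub>1\<close>.\<close>

definition uv_step :: "(real \<Rightarrow> real) \<Rightarrow> real \<times> real \<Rightarrow> real \<times> real" where
  "uv_step \<Psi> = (\<lambda>(u, v). (u * \<Psi> (u + v), u + v))"

definition uv_state :: "(real \<Rightarrow> real) \<Rightarrow> real \<times> real \<Rightarrow> nat \<Rightarrow> real \<times> real" where
  "uv_state \<Psi> p n = (uv_step \<Psi> ^^ n) p"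

text \<open>\<open>Inf\<close> on the reals is only meaningful for nonempty sets bounded below. The set used here
  is bounded below by \<open>0\<close>, and it is nonempty whenever \<open>\<Psi>\<close> is positive and nondecreasing
  with \<open>\<Psi> 0 = 1\<close>: every \<open>u > \<bar>v\<bar>\<close> belongs to it.\<close>

definition critical_curve :: "(real \<Rightarrow> real) \<Rightarrow> real \<Rightarrow> real" where
  "critical_curve \<Psi> v =
     Inf {u \<in> {0..}. filterlim (\<lambda>n. snd (uv_state \<Psi> (u, v) n)) at_top sequentially}"

end

theory Submission
  imports Defs
begin

text \<open>
  Started on the critical curve, the trajectory has to run into the origin: \<open>v\<^sub>n\<close>
  increases to \<open>0\<close> through negative values. The reason is that both alternatives are open in the
  starting value of \<open>u\<close>. If some \<open>v\<^sub>n\<close> were positive, the trajectory would escape to infinity,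
  and by continuity so would trajectories with slightly smaller \<open>u\<close>. If \<open>v\<^sub>n\<close> converged to a
  negative number, then from some time on \<open>u\<close> would shrink by a factor
  \<open>q < 1\<close> in each step, the remaining total displacement would be at most \<open>u\<^sub>n / (1 - q)\<close>, and
  this would still confine slightly larger starting values to the negative axis. Neither is
  possible at the infimum of the escaping starting values (\<open>critical_trajectory\<close>).

  For a trajectory ending at the origin put \<open>w\<^sub>n = - v\<^sub>n > 0\<close>, so that
  \<open>u\<^sub>n = w\<^sub>n - w\<^sub>n\<^sub>+\<^sub>1\<close>. The recursion is a discrete form of \<open>v' = u\<close>, \<open>u' = u v\<close>, for which
  \<open>u - v\<^sup>2 / 2\<close> is conserved. Correspondingly,
  \<open>u\<^sub>n - u\<^sub>n\<^sub>+\<^sub>1 = (w\<^sub>n - w\<^sub>n\<^sub>+\<^sub>1) (1 - \<Psi>(v\<^sub>n\<^sub>+\<^sub>1))\<close>,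
  and since \<open>\<Psi>\<close> has slope \<open>1\<close> at \<open>0\<close> the right-hand side is close to
  \<open>(w\<^sub>n - w\<^sub>n\<^sub>+\<^sub>1) w\<^sub>n\<^sub>+\<^sub>1\<close>, roughly half the decrement of \<open>w\<^sup>2\<close>. Summing the decrements by the
  Stolz--Cesaro theorem gives \<open>u\<^sub>n / w\<^sub>n\<^sup>2 \<longlonglongrightarrow> 1 / 2\<close>. Then \<open>1 / w\<^sub>n\<close> has
  increments \<open>u\<^sub>n / (w\<^sub>n w\<^sub>n\<^sub>+\<^sub>1)\<close> tending to \<open>1 / 2\<close>, so that \<open>w\<^sub>n\<close> behaves like \<open>2 / n\<close>
  and \<open>u\<^sub>n\<close> like \<open>2 / n\<^sup>2\<close> (\<open>trajectory_asymptotics\<close>).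
\<close>

section \<open>Limits from increments\<close>

text \<open>
  The \<open>0/0\<close> form of the Stolz--Cesaro theorem. An upper bound \<open>c\<close> on the ratios of decrements
  makes \<open>a - c * b\<close> eventually increasing; as it tends to \<open>0\<close>, it is eventually nonpositive.
  Applying this to \<open>- a\<close> as well gives both sides of the limit.
\<close>

lemma stolz_cesaro_zero:
  fixes a b :: "nat \<Rightarrow> real"
  assumes a: "a \<longlonglongrightarrow> 0" and b: "b \<longlonglongrightarrow> 0"
    and dec: "\<And>n. b (Suc n) < b n"
    and lim: "(\<lambda>n. (a n - a (Suc n)) / (b n - b (Suc n))) \<longlonglongrightarrow> l"
  shows "(\<lambda>n. a n / b n) \<longlonglongrightarrow> l"
proof -
  have b_pos: "b n > 0" for n
  proof -
    have "decseq b" using dec by (intro decseq_SucI) (simp add: less_imp_le)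
    then have "b (Suc n) \<ge> 0" using b by (rule decseq_ge)
    then show ?thesis using dec[of n] by linarith
  qed
  have upper: "\<forall>\<^sub>F n in sequentially. a n / b n < y"
    if a: "a \<longlonglongrightarrow> 0" and lim: "(\<lambda>n. (a n - a (Suc n)) / (b n - b (Suc n))) \<longlonglongrightarrow> l"
      and "l < y" for a :: "nat \<Rightarrow> real" and l y
  proof -
    obtain c where c: "l < c" "c < y" using \<open>l < y\<close> dense by blast
    obtain N where N: "(a n - a (Suc n)) / (b n - b (Suc n)) < c" if "n \<ge> N" for n
      using order_tendstoD(2)[OF lim c(1)] by (auto simp: eventually_sequentially)
    have "a n / b n < y" if "n \<ge> N" for n
    proof -
      have "a k - c * b k \<le> a (Suc k) - c * b (Suc k)" if "k \<ge> N" for k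
        using N[OF that] dec[of k] by (simp add: divide_simps algebra_simps)
      then have "incseq (\<lambda>k. a (k + n) - c * b (k + n))"
        using \<open>n \<ge> N\<close> by (intro incseq_SucI) simp
      moreover have "(\<lambda>k. a (k + n) - c * b (k + n)) \<longlonglongrightarrow> 0 - c * 0"
        by (intro tendsto_intros LIMSEQ_ignore_initial_segment a b)
      ultimately have "a (0 + n) - c * b (0 + n) \<le> 0 - c * 0" by (rule incseq_le)
      then have "a n / b n \<le> c" using b_pos[of n] by (simp add: divide_simps)
      then show ?thesis using c by simp
    qed
    then show ?thesis by (auto simp: eventually_sequentially)
  qed
  show ?thesis
  proof (rule order_tendstoI)
    show "\<forall>\<^sub>F n in sequentially. a n / b n < y" if "l < y" for y
      using upper[OF a lim that] .
    show "\<forall>\<^sub>F n in sequentially. y < a n / b n" if "y < l" for y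
    proof -
      have "(\<lambda>n. (- a n - - a (Suc n)) / (b n - b (Suc n))) \<longlonglongrightarrow> - l"
        using tendsto_minus[OF lim] by (simp add: minus_divide_left)
      with tendsto_minus[OF a] have "\<forall>\<^sub>F n in sequentially. - a n / b n < - y"
        using that by (intro upper) auto
      then show ?thesis by simp
    qed
  qed
qed

text \<open>
  A bound \<open>c\<close> on the increments from \<open>N\<close> on puts \<open>x\<close> below a line of slope \<open>c\<close>, whose intercept
  is negligible after division by \<open>n\<close>.
\<close>
lemma cesaro_increments:
  fixes x :: "nat \<Rightarrow> real"
  assumes lim: "(\<lambda>n. x (Suc n) - x n) \<longlonglongrightarrow> l"
  shows "(\<lambda>n. x n / real n) \<longlonglongrightarrow> l"
proof -
  have upper: "\<forall>\<^sub>F n in sequentially. x n / real n < y"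
    if lim: "(\<lambda>n. x (Suc n) - x n) \<longlonglongrightarrow> l" and "l < y" for x :: "nat \<Rightarrow> real" and l y
  proof -
    obtain c where c: "l < c" "c < y" using \<open>l < y\<close> dense by blast
    obtain N where N: "x (Suc n) - x n < c" if "n \<ge> N" for n
      using order_tendstoD(2)[OF lim c(1)] by (auto simp: eventually_sequentially)
    have le: "x n \<le> x N + c * (real n - real N)" if "n \<ge> N" for n
      using that
    proof (induction n rule: dec_induct)
      case (step n)
      then show ?case using N[of n] by (simp add: algebra_simps)
    qed simp
    have "(\<lambda>n. (x N - c * real N) / real n + c) \<longlonglongrightarrow> 0 + c"
      by (intro tendsto_intros lim_const_over_n)
    then have "\<forall>\<^sub>F n in sequentially. (x N - c * real N) / real n + c < y"
      using c by (intro order_tendstoD(2)) auto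
    moreover have "\<forall>\<^sub>F n in sequentially. x n / real n \<le> (x N - c * real N) / real n + c"
      using eventually_ge_at_top[of "Suc N"]
    proof eventually_elim
      case (elim n)
      then show ?case using le[of n] by (simp add: field_simps)
    qed
    ultimately show ?thesis by eventually_elim linarith
  qed
  show ?thesis
  proof (rule order_tendstoI)
    show "\<forall>\<^sub>F n in sequentially. x n / real n < y" if "l < y" for y
      using upper[OF lim that] .
    show "\<forall>\<^sub>F n in sequentially. y < x n / real n" if "y < l" for y
    proof -
      have "(\<lambda>n. - x (Suc n) - - x n) \<longlonglongrightarrow> - l"
        using tendsto_minus[OF lim] by simp
      then have "\<forall>\<^sub>F n in sequentially. - x n / real n < - y"
        using that by (intro upper) auto
      then show ?thesis by simp
    qed
  qed
qed

section \<open>The recursion and its dependence on the starting point\<close>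

locale uv_recursion =
  fixes \<Psi> :: "real \<Rightarrow> real"
  assumes \<Psi>_pos: "\<Psi> x > 0"
    and \<Psi>_mono: "mono \<Psi>"
    and \<Psi>_cont: "continuous_on UNIV \<Psi>"
    and \<Psi>_0: "\<Psi> 0 = 1"
    and \<Psi>_deriv: "(\<Psi> has_real_derivative 1) (at 0)"
begin

abbreviation U :: "real \<Rightarrow> real \<Rightarrow> nat \<Rightarrow> real" where
  "U u v n \<equiv> fst (uv_state \<Psi> (u, v) n)"

abbreviation V :: "real \<Rightarrow> real \<Rightarrow> nat \<Rightarrow> real" where
  "V u v n \<equiv> snd (uv_state \<Psi> (u, v) n)"

lemma UV_0 [simp]: "U u v 0 = u" "V u v 0 = v"
  by (simp_all add: uv_state_def)

lemma V_Suc [simp]: "V u v (Suc n) = U u v n + V u v n"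
  by (simp add: uv_state_def uv_step_def split: prod.split)

lemma U_Suc [simp]: "U u v (Suc n) = U u v n * \<Psi> (U u v n + V u v n)"
  by (simp add: uv_state_def uv_step_def split: prod.split)

lemma U_nonneg: "0 \<le> u \<Longrightarrow> 0 \<le> U u v n"
  by (induction n) (auto simp: \<Psi>_pos less_imp_le)

lemma U_pos: "0 < u \<Longrightarrow> 0 < U u v n"
  by (induction n) (auto simp: \<Psi>_pos)

lemma UV_at_zero: "U 0 v n = 0 \<and> V 0 v n = v"
  by (induction n) auto

lemma UV_mono_start:
  assumes "0 \<le> u" "u \<le> u'"
  shows "U u v n \<le> U u' v n \<and> V u v n \<le> V u' v n"
proof (induction n)
  case (Suc n)
  then have "\<Psi> (U u v n + V u v n) \<le> \<Psi> (U u' v n + V u' v n)"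
    by (intro monoD[OF \<Psi>_mono]) simp
  then show ?case
    using Suc U_nonneg[of u v n] U_nonneg[of u' v n] assms \<Psi>_pos
    by (auto intro!: mult_mono simp: less_imp_le)
qed (use assms in auto)

lemma UV_continuous_start:
  "continuous_on UNIV (\<lambda>u. U u v n) \<and> continuous_on UNIV (\<lambda>u. V u v n)"
proof (induction n)
  case (Suc n)
  then have "continuous_on UNIV (\<lambda>u. \<Psi> (U u v n + V u v n))"
    by (intro continuous_on_compose2[OF \<Psi>_cont] continuous_on_add; blast)
  with Suc show ?case
    unfolding U_Suc V_Suc by (intro conjI continuous_on_mult continuous_on_add; blast)
qed auto

lemma V_incseq: "0 \<le> u \<Longrightarrow> incseq (V u v)"
  by (intro incseq_SucI) (simp add: U_nonneg)

section \<open>The critical starting point\<close>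

text \<open>
  Once \<open>V\<close> is positive, the factors \<open>\<Psi> (V u v n)\<close> are at least \<open>\<Psi> 0 = 1\<close>, so that \<open>U\<close> no
  longer decreases and \<open>V\<close> grows at least linearly. Escape is thus visible at a finite time, which
  makes it an open condition on the starting point.
\<close>
lemma V_at_top_iff:
  assumes "0 \<le> u" "v < 0"
  shows "filterlim (V u v) at_top sequentially \<longleftrightarrow> (\<exists>n. V u v n > 0)"
proof
  assume "filterlim (V u v) at_top sequentially"
  then have "\<forall>\<^sub>F n in sequentially. V u v n > 0"
    by (simp add: filterlim_at_top_dense)
  then show "\<exists>n. V u v n > 0"
    using eventually_happens trivial_limit_sequentially by blast
next
  assume "\<exists>n. V u v n > 0"
  then obtain N where N: "V u v N > 0" by blast
  have "u > 0"
    using N assms UV_at_zero[of v N] by (cases "u = 0") auto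
  have "U u v N \<le> U u v (k + N) \<and> V u v N + real k * U u v N \<le> V u v (k + N)" for k
  proof (induction k)
    case (Suc k)
    have "0 \<le> real k * U u v N" using U_nonneg[OF assms(1)] by simp
    then have "\<Psi> 0 \<le> \<Psi> (U u v (k + N) + V u v (k + N))"
      using Suc N U_nonneg[OF assms(1), of v "k + N"] by (intro monoD[OF \<Psi>_mono]) linarith
    from mult_left_mono[OF this U_nonneg[OF assms(1), of v "k + N"]]
    have "U u v (k + N) \<le> U u v (Suc k + N)"
      by (simp add: \<Psi>_0)
    with Suc show ?case by (simp add: algebra_simps)
  qed simp
  then have le: "V u v N + real k * U u v N \<le> V u v (k + N)" for k by blast
  have "filterlim (\<lambda>k. V u v N + real k * U u v N) at_top sequentially"
    by (intro filterlim_tendsto_add_at_top[OF tendsto_const]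
        filterlim_at_top_mult_tendsto_pos[OF tendsto_const] filterlim_real_sequentially
        U_pos[OF \<open>u > 0\<close>])
  then have "filterlim (\<lambda>k. V u v (k + N)) at_top sequentially"
    by (rule filterlim_at_top_mono) (simp add: le)
  then show "filterlim (V u v) at_top sequentially"
    unfolding filterlim_at_top
    using eventually_sequentially_seg[of "\<lambda>n. Z \<le> V u v n" N for Z] by blast
qed

text \<open>
  Monotonicity extends the strict inequality from a left neighbourhood of \<open>0\<close>, where it follows
  from the positive derivative, to the whole negative axis.
\<close>
lemma \<Psi>_less_1:
  assumes "x < 0"
  shows "\<Psi> x < 1"
proof -
  obtain d where d: "d > 0" "\<And>h. 0 < h \<Longrightarrow> h < d \<Longrightarrow> \<Psi> (0 - h) < \<Psi> 0"
    using DERIV_pos_inc_left[OF \<Psi>_deriv] by auto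
  define h where "h = min (d / 2) (- x)"
  have "\<Psi> x \<le> \<Psi> (0 - h)" by (intro monoD[OF \<Psi>_mono]) (simp add: h_def)
  also have "\<dots> < 1" using d assms by (simp add: h_def \<Psi>_0)
  finally show ?thesis .
qed

text \<open>
  The sum \<open>V + U / (1 - \<Psi> m)\<close> bounds the final position of a trajectory whose \<open>U\<close> shrinks by at
  least the factor \<open>\<Psi> m\<close> in every step, by a geometric series. As long as it is at most \<open>m\<close>, the
  next value of \<open>V\<close> is also at most \<open>m\<close>, the shrinking does take place, and the sum does not
  increase; so the bound perpetuates itself. It is a condition at the single time \<open>N\<close>, hence
  stable under small perturbations when strict.
\<close>
lemma V_trapped:
  assumes "0 \<le> u" "m < 0" and start: "V u v N + U u v N / (1 - \<Psi> m) \<le> m"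
  shows "V u v (k + N) \<le> m"
proof -
  define q where "q = \<Psi> m"
  have q: "q < 1" using \<Psi>_less_1[OF \<open>m < 0\<close>] by (simp add: q_def)
  have q0: "q > 0" by (simp add: q_def \<Psi>_pos)
  have "V u v (k + N) + U u v (k + N) / (1 - q) \<le> m"
  proof (induction k)
    case 0
    then show ?case using start by (simp add: q_def)
  next
    case (Suc k)
    let ?U = "U u v (k + N)" and ?V = "V u v (k + N)"
    have U0: "?U \<ge> 0" using U_nonneg[OF \<open>0 \<le> u\<close>] .
    have split: "?U / (1 - q) = ?U + q * ?U / (1 - q)"
      using q by (simp add: field_simps)
    have "0 \<le> q * ?U / (1 - q)" using U0 q q0 by simp
    then have "?U + ?V \<le> m" using Suc split by linarith
    then have "\<Psi> (?U + ?V) \<le> q" unfolding q_def by (rule monoD[OF \<Psi>_mono])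
    from mult_left_mono[OF this U0] have "U u v (Suc k + N) \<le> q * ?U"
      by (simp add: mult.commute)
    then have "U u v (Suc k + N) / (1 - q) \<le> q * ?U / (1 - q)"
      using q by (simp add: divide_right_mono)
    then show ?case using Suc split by simp
  qed
  moreover have "0 \<le> U u v (k + N) / (1 - q)" using U_nonneg[OF \<open>0 \<le> u\<close>] q by simp
  ultimately show ?thesis by linarith
qed

text \<open>
  Were some \<open>V h v n\<close> positive, starting values just below \<open>h\<close> would escape; were the limit of
  \<open>V h v\<close> negative, starting values just above \<open>h\<close> would be trapped, and by monotonicity nothing
  below them could escape. Both contradict that \<open>h\<close> is the infimum of the escaping values.
\<close>
lemma critical_trajectory:
  assumes "v < 0"
  defines "h \<equiv> critical_curve \<Psi> v"
  shows "0 < h" and "V h v n < 0" and "V h v \<longlonglongrightarrow> 0"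
proof -
  define S where "S = {u. 0 \<le> u \<and> (\<exists>n. V u v n > 0)}"
  have h: "h = Inf S"
    unfolding h_def critical_curve_def S_def using V_at_top_iff[OF _ \<open>v < 0\<close>]
    by (intro arg_cong[where f = Inf]) auto
  have "1 - v \<in> S" using assms by (auto simp: S_def intro!: exI[of _ "Suc 0"])
  then have ne: "S \<noteq> {}" by blast
  have bdd: "bdd_below S" by (rule bdd_belowI[of _ 0]) (simp add: S_def)
  have h0: "h \<ge> 0" unfolding h by (rule cInf_greatest[OF ne]) (simp add: S_def)
  have cont: "isCont (\<lambda>u. V u v n) h" "isCont (\<lambda>u. U u v n) h" for n
    using UV_continuous_start[of v n] by (auto simp: continuous_on_eq_continuous_at)
  have V_le: "V h v n \<le> 0" for n
  proof (rule ccontr)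
    assume "\<not> V h v n \<le> 0"
    then have V: "V h v n > 0" by simp
    then have "h > 0" using h0 assms UV_at_zero[of v n] by (cases "h = 0") auto
    have "\<forall>\<^sub>F u in at_left h. V u v n > 0"
      using order_tendstoD(1)[OF cont(1)[unfolded isCont_def] V]
      by (rule filter_leD[OF at_le, rotated]) simp
    moreover have "\<forall>\<^sub>F u in at_left h. 0 < u \<and> u < h"
      using eventually_at_left_real[OF \<open>h > 0\<close>] by simp
    ultimately have "\<forall>\<^sub>F u in at_left h. u \<in> S \<and> u < h"
      by eventually_elim (auto simp: S_def)
    then obtain u where "u \<in> S" "u < h"
      using eventually_happens[of _ "at_left h"] by auto
    then show False using cInf_lower[OF _ bdd] h by fastforce
  qed
  obtain L where L: "V h v \<longlonglongrightarrow> L"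
    using incseq_convergent[OF V_incseq[OF h0]] V_le by metis
  have L0: "L \<le> 0" using L V_le by (intro LIMSEQ_le_const2[OF L]) auto
  have "L = 0"
  proof (rule ccontr)
    assume "L \<noteq> 0"
    \<comment> \<open>Any barrier strictly between the limit and \<open>0\<close> would do.\<close>
    define m where "m = L / 2"
    have m: "L < m" "m < 0" using L0 \<open>L \<noteq> 0\<close> by (auto simp: m_def)
    define G where "G = (\<lambda>u n. V u v n + U u v n / (1 - \<Psi> m))"
    have ne1: "1 - \<Psi> m \<noteq> 0" using \<Psi>_less_1[OF m(2)] by simp
    have "(\<lambda>n. V h v (Suc n) - V h v n) \<longlonglongrightarrow> L - L"
      by (intro tendsto_diff LIMSEQ_Suc L)
    then have "U h v \<longlonglongrightarrow> 0" by simp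
    then have "(\<lambda>n. G h n) \<longlonglongrightarrow> L + 0 / (1 - \<Psi> m)"
      unfolding G_def using ne1 by (intro tendsto_intros L)
    then have "\<forall>\<^sub>F n in sequentially. G h n < m"
      using m by (intro order_tendstoD(2)) auto
    then obtain N where N: "G h N < m"
      using eventually_happens trivial_limit_sequentially by blast
    have "isCont (\<lambda>u. G u N) h"
      unfolding G_def using ne1 by (intro continuous_intros cont)
    then have "\<forall>\<^sub>F u in at_right h. G u N < m"
      using order_tendstoD(2)[OF _ N] filter_leD[OF at_le[of "{h<..}" UNIV h]]
      unfolding isCont_def by blast
    moreover have "\<forall>\<^sub>F u in at_right h. h < u"
      by (simp add: eventually_at_right_less)
    ultimately have "\<forall>\<^sub>F u in at_right h. h < u \<and> G u N < m"
      by eventually_elim simp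
    then obtain u where u: "h < u" "G u N < m"
      using eventually_happens[of _ "at_right h"] by auto
    then obtain s where s: "s \<in> S" "s < u"
      using cInf_lessD[OF ne] h by blast
    then obtain n where n: "V s v n > 0" "0 \<le> s" by (auto simp: S_def)
    have "V s v n \<le> V s v (n + N)" by (rule incseqD[OF V_incseq[OF n(2)]]) simp
    also have "\<dots> \<le> V u v (n + N)" using UV_mono_start[of s u] n s by simp
    also have "\<dots> \<le> m" using u h0 m by (intro V_trapped) (auto simp: G_def)
    finally show False using n m by simp
  qed
  with L show lim: "V h v \<longlonglongrightarrow> 0" by simp
  have "h \<noteq> 0"
  proof
    assume "h = 0"
    then have "(\<lambda>n. v) \<longlonglongrightarrow> 0" using lim UV_at_zero[of v] by simp
    then show False using assms by (simp add: LIMSEQ_const_iff)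
  qed
  with h0 show pos: "0 < h" by simp
  show "V h v n < 0" using V_le[of "Suc n"] U_pos[OF pos, of v n] by simp
qed

section \<open>Asymptotics of trajectories that end at the origin\<close>

text \<open>
  Stolz--Cesaro is used twice. Against \<open>w\<close>, the quotient of decrements of \<open>u\<close> is
  \<open>1 - \<Psi> (v (Suc n))\<close>, which tends to \<open>0\<close>; so \<open>u\<close> is negligible compared with \<open>w\<close>, that is,
  consecutive values of \<open>w\<close> are asymptotically equal. With this in hand, the
  quotient of decrements against \<open>w\<^sup>2\<close> converges to \<open>1 / 2\<close>.
\<close>
lemma trajectory_asymptotics:
  assumes pos: "\<And>n. 0 < u n" and neg: "\<And>n. v n < 0" and lim: "v \<longlonglongrightarrow> 0"
    and v_Suc: "\<And>n. v (Suc n) = u n + v n"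
    and u_Suc: "\<And>n. u (Suc n) = u n * \<Psi> (v (Suc n))"
  shows "(\<lambda>n. real n * v n) \<longlonglongrightarrow> - 2" and "(\<lambda>n. real n ^ 2 * u n) \<longlonglongrightarrow> 2"
proof -
  define w where "w n = - v n" for n
  have w_pos: "w n > 0" for n using neg by (simp add: w_def)
  have w_lim: "w \<longlonglongrightarrow> 0" using tendsto_minus[OF lim] by (simp add: w_def[abs_def])
  have u_eq: "u n = w n - w (Suc n)" for n by (simp add: w_def v_Suc)
  have w_dec: "w (Suc n) < w n" for n using pos[of n] u_eq[of n] by simp
  have "(\<lambda>n. w n - w (Suc n)) \<longlonglongrightarrow> 0 - 0" by (intro tendsto_diff LIMSEQ_Suc w_lim)
  then have u_lim: "u \<longlonglongrightarrow> 0" by (simp add: u_eq[abs_def])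
  define g where "g n = 1 - \<Psi> (v n)" for n
  have du: "u n - u (Suc n) = (w n - w (Suc n)) * g (Suc n)" for n
    by (simp add: u_Suc g_def algebra_simps flip: u_eq)
  have slope: "(\<lambda>n. g n / w n) \<longlonglongrightarrow> 1"
  proof -
    have "((\<lambda>x. (\<Psi> x - \<Psi> 0) / (x - 0)) \<longlongrightarrow> 1) (at 0)"
      using \<Psi>_deriv by (simp add: has_field_derivative_iff)
    moreover have "filterlim v (at 0) sequentially"
      using lim neg by (auto simp: filterlim_at less_imp_neq)
    ultimately have "(\<lambda>n. (\<Psi> (v n) - \<Psi> 0) / (v n - 0)) \<longlonglongrightarrow> 1"
      by (rule filterlim_compose)
    moreover have "(\<Psi> (v n) - \<Psi> 0) / (v n - 0) = g n / w n" for n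
      using neg[of n] by (simp add: g_def w_def \<Psi>_0 field_simps)
    ultimately show ?thesis by simp
  qed
  have "(\<lambda>n. g n / w n * w n) \<longlonglongrightarrow> 1 * 0" by (intro tendsto_mult slope w_lim)
  then have g_lim: "g \<longlonglongrightarrow> 0" using w_pos by (simp add: less_imp_neq[symmetric])
  have uw: "(\<lambda>n. u n / w n) \<longlonglongrightarrow> 0"
  proof (rule stolz_cesaro_zero[OF u_lim w_lim w_dec])
    have "(u n - u (Suc n)) / (w n - w (Suc n)) = g (Suc n)" for n
      using w_dec[of n] by (simp add: du)
    then show "(\<lambda>n. (u n - u (Suc n)) / (w n - w (Suc n))) \<longlonglongrightarrow> 0"
      using LIMSEQ_Suc[OF g_lim] by simp
  qed
  have w_ratio: "(\<lambda>n. w (Suc n) / w n) \<longlonglongrightarrow> 1"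
  proof -
    have "(\<lambda>n. 1 - u n / w n) \<longlonglongrightarrow> 1 - 0" by (intro tendsto_intros uw)
    moreover have "1 - u n / w n = w (Suc n) / w n" for n
      using w_pos[of n] by (simp add: u_eq field_simps)
    ultimately show ?thesis by simp
  qed
  have uww: "(\<lambda>n. u n / w n ^ 2) \<longlonglongrightarrow> 1 / 2"
  proof (rule stolz_cesaro_zero[OF u_lim])
    show "(\<lambda>n. w n ^ 2) \<longlonglongrightarrow> 0" using tendsto_power[OF w_lim, of 2] by simp
    show "w (Suc n) ^ 2 < w n ^ 2" for n
      using w_dec[of n] w_pos[of "Suc n"] by (intro power_strict_mono) auto
    have "(\<lambda>n. g (Suc n) / w (Suc n) * (w (Suc n) / w n / (1 + w (Suc n) / w n)))
        \<longlonglongrightarrow> 1 * (1 / (1 + 1))"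
      by (intro tendsto_intros LIMSEQ_Suc[OF slope] w_ratio) simp
    moreover have "(u n - u (Suc n)) / (w n ^ 2 - w (Suc n) ^ 2)
        = g (Suc n) / w (Suc n) * (w (Suc n) / w n / (1 + w (Suc n) / w n))" for n
    proof -
      have "(u n - u (Suc n)) / (w n ^ 2 - w (Suc n) ^ 2)
          = (w n - w (Suc n)) * g (Suc n) / ((w n - w (Suc n)) * (w n + w (Suc n)))"
        by (simp add: du power2_eq_square algebra_simps)
      also have "\<dots> = g (Suc n) / (w n + w (Suc n))" using w_dec[of n] by simp
      also have "\<dots> = g (Suc n) / w (Suc n) * (w (Suc n) / w n / (1 + w (Suc n) / w n))"
        using w_pos[of n] w_pos[of "Suc n"] by (simp add: divide_simps)
      finally show ?thesis .
    qed
    ultimately show "(\<lambda>n. (u n - u (Suc n)) / (w n ^ 2 - w (Suc n) ^ 2)) \<longlonglongrightarrow> 1 / 2" by simp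
  qed
  have "(\<lambda>n. 1 / w n / real n) \<longlonglongrightarrow> 1 / 2"
  proof (rule cesaro_increments)
    have "(\<lambda>n. u n / w n ^ 2 / (w (Suc n) / w n)) \<longlonglongrightarrow> 1 / 2 / 1"
      by (intro tendsto_divide uww w_ratio) simp
    moreover have "u n / w n ^ 2 / (w (Suc n) / w n) = 1 / w (Suc n) - 1 / w n" for n
      using w_pos[of n] w_pos[of "Suc n"] by (simp add: u_eq field_simps power2_eq_square)
    ultimately show "(\<lambda>n. 1 / w (Suc n) - 1 / w n) \<longlonglongrightarrow> 1 / 2" by simp
  qed
  then have "(\<lambda>n. inverse (1 / w n / real n)) \<longlonglongrightarrow> inverse (1 / 2)"
    by (rule tendsto_inverse) simp
  then have nw: "(\<lambda>n. real n * w n) \<longlonglongrightarrow> 2" by (simp add: mult.commute)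
  then show "(\<lambda>n. real n * v n) \<longlonglongrightarrow> - 2"
    using tendsto_minus[OF nw] by (simp add: w_def)
  have "(\<lambda>n. u n / w n ^ 2 * (real n * w n) ^ 2) \<longlonglongrightarrow> 1 / 2 * 2 ^ 2"
    by (intro tendsto_intros uww nw)
  moreover have "u n / w n ^ 2 * (real n * w n) ^ 2 = real n ^ 2 * u n" for n
    using w_pos[of n] by (simp add: power_mult_distrib)
  ultimately show "(\<lambda>n. real n ^ 2 * u n) \<longlonglongrightarrow> 2" by simp
qed

end

section \<open>The critical trajectory\<close>

theorem theorem1p4:
  fixes \<Psi> :: "real \<Rightarrow> real" and u v :: "nat \<Rightarrow> real"
  assumes "\<And>x. \<Psi> x > 0"
    and "bounded (range \<Psi>)"
    and "mono \<Psi>"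
    and "C2 \<Psi>"
    and "\<Psi> 0 = 1"
    and "deriv \<Psi> 0 = 1"
    and "v 0 < 0"
    and "u 0 = critical_curve \<Psi> (v 0)"
    and "\<And>n. v (Suc n) = u n + v n"
    and "\<And>n. u (Suc n) = u n * \<Psi> (v (Suc n))"
  shows "u \<sim>[at_top] (\<lambda>n. 2 / real n ^ 2) \<and> v \<sim>[at_top] (\<lambda>n. - 2 / real n)"
proof -
  have diff: "\<Psi> differentiable (at x)" for x using assms(4) by (simp add: C2_def)
  interpret uv_recursion \<Psi>
  proof
    show "continuous_on UNIV \<Psi>"
      using diff by (auto intro!: differentiable_imp_continuous_on simp: differentiable_on_def)
    show "(\<Psi> has_real_derivative 1) (at 0)"
      using diff[of 0] assms(6) by (metis DERIV_deriv_iff_real_differentiable)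
  qed (use assms in auto)
  have uv: "u n = U (u 0) (v 0) n \<and> v n = V (u 0) (v 0) n" for n
    by (induction n) (auto simp: assms(9,10))
  note crit = critical_trajectory[OF assms(7), folded assms(8)]
  have "v = V (u 0) (v 0)" using uv by blast
  then have "v \<longlonglongrightarrow> 0" using crit(3) by simp
  moreover have "u n > 0" "v n < 0" for n
    using uv[of n] crit(2)[of n] U_pos[OF crit(1)] by simp_all
  ultimately have lim: "(\<lambda>n. real n * v n) \<longlonglongrightarrow> - 2" "(\<lambda>n. real n ^ 2 * u n) \<longlonglongrightarrow> 2"
    using trajectory_asymptotics[of u v] assms(9,10) by blast+
  have "(\<lambda>n. real n ^ 2 * u n / 2) \<longlonglongrightarrow> 2 / 2" "(\<lambda>n. real n * v n / - 2) \<longlonglongrightarrow> - 2 / - 2"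
    by (intro tendsto_intros lim; simp)+
  then show ?thesis
    by (auto intro!: asymp_equivI' simp: mult.commute)
qed

end
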